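(* Let $f$ be a continuous convex real-valued function defined on a closed interval $I := [a,b] \subset \mathbb{R}$. For $s,t \in I$ put $$F(s,t) := f(s)+f(t)-2f\left(\frac{s+t}{2}\right).$$ Then $$\max_{s,t\in I} F(s,t) = F(a,b).$$
   Context: A function $\phi$ on an interval is called convex if $\frac{\phi(x)+\phi(y)}{2}\ge \phi\left(\frac{x+y}{2}\right)$ for all $x,y$ in the interval; for continuous functions this is equivalent to the usual notion of convexity. *)

theory Defs
  imports "HOL-Analysis.Analysis"
begin

text \<open>Convexity in the midpoint sense. This is weaker than the library's \<open>convex_on\<close> for
  general functions and agrees with it for continuous ones.\<close>

definition midpoint_convex_on :: "real set \<Rightarrow> (real \<Rightarrow> real) \<Rightarrow> bool" where
  "midpoint_convex_on I \<phi> \<longleftrightarrow>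
     (\<forall>x\<in>I. \<forall>y\<in>I. (\<phi> x + \<phi> y) / 2 \<ge> \<phi> ((x + y) / 2))"

definition midpoint_gap :: "(real \<Rightarrow> real) \<Rightarrow> real \<Rightarrow> real \<Rightarrow> real" where
  "midpoint_gap f s t = f s + f t - 2 * f ((s + t) / 2)"

text \<open>The library's \<open>Max\<close> is specified only for finite sets, so the maximum of an arbitrary set
  is expressed as a relation; it includes attainment.\<close>

definition is_maximum :: "real set \<Rightarrow> real \<Rightarrow> bool" where
  "is_maximum A m \<longleftrightarrow> m \<in> A \<and> (\<forall>y\<in>A. y \<le> m)"

end

theory Submission imports Defs begin

text \<open>For continuous functions midpoint convexity is ordinary convexity, and for a convex
  function the gap grows when one of its arguments moves away from the other one. So moving first
  one and then the other argument out to an endpoint of the interval gives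
  \<open>F s t \<le> F a t \<le> F a b\<close> when \<open>s \<le> t\<close>, and the gap is symmetric in its arguments.

  The monotonicity (\<open>midpoint_gap_mono\<close>) is majorization: moving the argument \<open>s\<close> outwards to
  \<open>u\<close> replaces the three points \<open>s, (u + t)/2, (u + t)/2\<close> by \<open>u, (s + t)/2, (s + t)/2\<close>. Both
  triples have the same sum, and the points of the first lie between \<open>u\<close> and \<open>(s + t)/2\<close>.
  The passage to ordinary convexity (\<open>midpoint_convex_on_imp_convex_on\<close>) is a maximum principle:
  a continuous midpoint convex function attains its maximum at an endpoint.\<close>

text \<open>At the leftmost maximum point, were it interior, the values on the left are strictly
  smaller and those on the right not larger, so their average is too small for midpoint
  convexity.\<close>

lemma midpoint_convex_on_le_endpoints:
  assumes cont: "continuous_on {u..v} g" and mid: "midpoint_convex_on {u..v} g"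
    and ends: "g u \<le> c" "g v \<le> c" and x: "x \<in> {u..v}"
  shows "g x \<le> c"
proof (rule ccontr)
  assume "\<not> g x \<le> c"
  obtain m where m: "m \<in> {u..v}" and max: "\<And>y. y \<in> {u..v} \<Longrightarrow> g y \<le> g m"
    using continuous_attains_sup[OF compact_Icc _ cont] x by (metis empty_iff)
  define S where "S = {y \<in> {u..v}. g y = g m}"
  have "closed S"
    unfolding S_def by (intro continuous_closed_preimage_constant cont closed_atLeastAtMost)
  moreover have "bounded S"
    by (rule bounded_subset[of "{u..v}"]) (auto simp: S_def)
  ultimately have "compact S"
    by (simp add: compact_eq_bounded_closed)
  moreover have "S \<noteq> {}"
    using m by (auto simp: S_def)
  ultimately obtain p where p: "p \<in> S" and least: "\<And>y. y \<in> S \<Longrightarrow> p \<le> y"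
    by (metis compact_attains_inf)
  have "g p > c"
    using p max[OF x] \<open>\<not> g x \<le> c\<close> by (simp add: S_def)
  then have "u < p" "p < v"
    using p ends by (auto simp: S_def order_less_le)
  define h where "h = min (p - u) (v - p)"
  have "h > 0" and left: "p - h \<in> {u..v}" and right: "p + h \<in> {u..v}"
    using \<open>u < p\<close> \<open>p < v\<close> by (auto simp: h_def)
  have "p - h \<notin> S"
    using least[of "p - h"] \<open>h > 0\<close> by linarith
  then have "g (p - h) \<noteq> g m"
    using left unfolding S_def by blast
  then have "g (p - h) < g p"
    using max[OF left] p by (simp add: S_def)
  moreover have "g (p + h) \<le> g p"
    using max[OF right] p by (simp add: S_def)
  moreover have "g p \<le> (g (p - h) + g (p + h)) / 2"
  proof -
    have "g (((p - h) + (p + h)) / 2) \<le> (g (p - h) + g (p + h)) / 2"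
      using mid left right unfolding midpoint_convex_on_def by blast
    then show ?thesis
      by simp
  qed
  ultimately show False
    by simp
qed

text \<open>Subtracting an affine function preserves midpoint convexity. With a multiple
  of \<open>x - u\<close> that makes the difference equal to \<open>f u\<close> at both endpoints of a chord, the
  maximum principle says that \<open>f\<close> lies below the chord.\<close>

lemma midpoint_convex_on_imp_convex_on:
  assumes cont: "continuous_on {a..b} f" and mid: "midpoint_convex_on {a..b} f"
  shows "convex_on {a..b} f"
proof (rule convex_on_linorderI)
  fix \<mu> u v :: real
  assume \<mu>: "0 < \<mu>" "\<mu> < 1" and uv: "u \<in> {a..b}" "v \<in> {a..b}" "u < v"
  define k where "k = (f v - f u) / (v - u)"
  define g where "g x = f x - k * (x - u)" for x
  have k: "k * (v - u) = f v - f u"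
    using uv by (simp add: k_def)
  have sub: "{u..v} \<subseteq> {a..b}"
    using uv by auto
  define x where "x = (1 - \<mu>) * u + \<mu> * v"
  have "x \<in> closed_segment u v"
    using \<mu> by (auto simp: x_def closed_segment_def)
  then have x: "x \<in> {u..v}"
    using uv by (simp add: closed_segment_eq_real_ivl)
  have "continuous_on {u..v} g"
    unfolding g_def by (intro continuous_intros continuous_on_subset[OF cont sub])
  moreover have "midpoint_convex_on {u..v} g"
    unfolding midpoint_convex_on_def
  proof (intro ballI)
    fix y z
    assume "y \<in> {u..v}" "z \<in> {u..v}"
    then have "f ((y + z) / 2) \<le> (f y + f z) / 2"
      using mid sub unfolding midpoint_convex_on_def by blast
    moreover have "(g y + g z) / 2 - g ((y + z) / 2) = (f y + f z) / 2 - f ((y + z) / 2)"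
      by (simp add: g_def field_simps)
    ultimately show "g ((y + z) / 2) \<le> (g y + g z) / 2"
      by linarith
  qed
  moreover have "g u \<le> f u" "g v \<le> f u"
    using k by (simp_all add: g_def)
  ultimately have "g x \<le> f u"
    using x by (rule midpoint_convex_on_le_endpoints)
  moreover have "k * (x - u) = \<mu> * (f v - f u)"
    unfolding k[symmetric] by (simp add: x_def algebra_simps)
  ultimately show "f ((1 - \<mu>) *\<^sub>R u + \<mu> *\<^sub>R v) \<le> (1 - \<mu>) * f u + \<mu> * f v"
    by (simp add: g_def x_def algebra_simps)
qed simp

lemma midpoint_gap_commute: "midpoint_gap f s t = midpoint_gap f t s"
  by (simp add: midpoint_gap_def add.commute)

text \<open>Stated with a segment, so that it covers moving the left argument to the left as well as
  moving the right argument to the right.\<close>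

lemma midpoint_gap_mono:
  assumes conv: "convex_on S f" and u: "u \<in> S" and t: "t \<in> S"
    and s: "s \<in> closed_segment u t"
  shows "midpoint_gap f s t \<le> midpoint_gap f u t"
proof -
  obtain c where c: "0 \<le> c" "c \<le> 1" and s_eq: "s = (1 - c) * u + c * t"
    using s by (auto simp: closed_segment_def)
  define m where "m = (s + t) / 2"
  have "closed_segment u t \<subseteq> S"
    using conv u t by (simp add: closed_segment_subset convex_on_imp_convex)
  moreover have "m \<in> closed_segment u t"
    unfolding in_segment
  proof (intro exI conjI)
    show "m = (1 - (1 + c) / 2) *\<^sub>R u + ((1 + c) / 2) *\<^sub>R t"
      by (simp add: m_def s_eq field_simps)
  qed (use c in simp_all)
  ultimately have m: "m \<in> S"
    by blast
  \<comment> \<open>\<open>l\<close> and \<open>r\<close> are the positions of \<open>s\<close> and of \<open>(u + t)/2\<close> on the segment from \<open>u\<close> to \<open>m\<close>;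
    equality of the sums of the two triples is the relation \<open>l + 2 * r = 2\<close>.\<close>
  define r where "r = 1 / (1 + c)"
  define l where "l = 2 * c * r"
  have rc: "r * (1 + c) = 1"
    using c by (simp add: r_def)
  have r: "0 \<le> r" "r \<le> 1"
    using c by (simp_all add: r_def)
  have lr: "l + 2 * r = 2"
    using rc by (simp add: l_def algebra_simps)
  have "c * r \<le> r"
    using c r by (simp add: mult_left_le_one_le)
  then have l: "0 \<le> l" "l \<le> 1"
    using c r lr unfolding l_def by (simp, linarith)
  have mu: "2 * (m - u) = (1 + c) * (t - u)"
    unfolding m_def s_eq by (simp add: field_simps)
  have rm: "2 * (r * (m - u)) = t - u"
    using arg_cong[OF mu, of "(*) r"] rc by (metis mult.assoc mult.left_commute mult_1)
  have "l * (m - u) = c * (2 * (r * (m - u)))"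
    by (simp add: l_def)
  also have "\<dots> = s - u"
    unfolding rm by (simp add: s_eq algebra_simps)
  finally have "s = (1 - l) * u + l * m"
    by (simp add: algebra_simps)
  then have "f s \<le> (1 - l) * f u + l * f m"
    using convex_onD[OF conv l u m] by simp
  moreover have mid_ut: "(u + t) / 2 = (1 - r) * u + r * m"
    using rm by (simp add: field_simps)
  have "f ((u + t) / 2) \<le> (1 - r) * f u + r * f m"
    unfolding mid_ut using convex_onD[OF conv r u m] by simp
  ultimately have "f s + 2 * f ((u + t) / 2) \<le> (3 - (l + 2 * r)) * f u + (l + 2 * r) * f m"
    by (simp add: algebra_simps)
  then show ?thesis
    unfolding lr by (simp add: midpoint_gap_def m_def)
qed

lemma midpoint_gap_le_endpoints:
  assumes conv: "convex_on {a..b} f" and st: "a \<le> s" "s \<le> t" "t \<le> b"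
  shows "midpoint_gap f s t \<le> midpoint_gap f a b"
proof -
  have "midpoint_gap f s t \<le> midpoint_gap f a t"
    using st by (intro midpoint_gap_mono[OF conv]) (auto simp: closed_segment_eq_real_ivl)
  also have "\<dots> = midpoint_gap f t a"
    by (rule midpoint_gap_commute)
  also have "\<dots> \<le> midpoint_gap f b a"
    using st by (intro midpoint_gap_mono[OF conv]) (auto simp: closed_segment_eq_real_ivl)
  also have "\<dots> = midpoint_gap f a b"
    by (rule midpoint_gap_commute)
  finally show ?thesis .
qed

theorem propositionX:
  fixes f :: "real \<Rightarrow> real" and a b :: real
  assumes "a \<le> b"
    and "continuous_on {a..b} f"
    and "midpoint_convex_on {a..b} f"
  shows "is_maximum {midpoint_gap f s t | s t. s \<in> {a..b} \<and> t \<in> {a..b}} (midpoint_gap f a b)"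
proof -
  have conv: "convex_on {a..b} f"
    using assms(2,3) by (rule midpoint_convex_on_imp_convex_on)
  have "midpoint_gap f s t \<le> midpoint_gap f a b" if "s \<in> {a..b}" "t \<in> {a..b}" for s t
  proof (cases "s \<le> t")
    case True
    then show ?thesis
      using that by (intro midpoint_gap_le_endpoints[OF conv]) auto
  next
    case False
    then have "midpoint_gap f t s \<le> midpoint_gap f a b"
      using that by (intro midpoint_gap_le_endpoints[OF conv]) auto
    then show ?thesis
      by (simp add: midpoint_gap_commute)
  qed
  moreover have "a \<in> {a..b}" "b \<in> {a..b}"
    using \<open>a \<le> b\<close> by auto
  ultimately show ?thesis
    unfolding is_maximum_def by blast
qed

end
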